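(* Let $\mathcal{X}$ and $\mathcal{Y}$ be Polish spaces, $X=(X_n)_{n\ge1}$ an $\mathcal{X}$-valued process, and $g:\mathcal{X}\to\mathcal{Y}$ a continuous map. Assume that $X$ is empirically weakly converging (EWC) in probability (resp. almost surely) with limit measure $P$. Then the $\mathcal{Y}$-valued process $g(X)=(g(X_n))_{n\ge1}$ is EWC in probability (resp. almost surely) with limit measure $Q=P\circ g^{-1}$ (the pushforward of $P$ by $g$).
   Context: All random variables are defined on a complete standard Borel probability space $(\Omega,\mathcal{A},\mathbb{P})$. Polish spaces carry their Borel $\sigma$-algebra. $\mathcal{P}(\mathcal{X})$ is the set of Borel probability measures on $\mathcal{X}$ with the topology of weak convergence (which is metrizable). A random measure on $\mathcal{X}$ is a measurable map $P:\Omega\to\mathcal{P}(\mathcal{X})$. The empirical measure of a process $X$ is $\eta_n^X=\frac1n\sum_{i=1}^n\delta_{X_i}$. Definition (EWC): let $d$ be a metric on $\mathcal{P}(\mathcal{X})$ that metrizes weak convergence. An $\mathcal{X}$-valued process $X$ is EWC in probability (resp. almost surely) if there exists a random measure $P$ on $\mathcal{X}$ such that $\lim_{n\to\infty}d(\eta_n^X,P)=0$ in probability (resp. almost surely); $P$ is then called a limit measure of $X$. *)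

theory Defs
  imports "HOL-Probability.Probability"
begin

definition standard_borel_measure :: "'a measure \<Rightarrow> bool" where
  "standard_borel_measure N \<longleftrightarrow>
     (\<exists>T. completely_metrizable_space T \<and> separable_space T \<and> topspace T = space N \<and>
          sets N = sigma_sets (space N) {U. openin T U})"

text \<open>A complete standard Borel probability space is the completion of a Borel probability
  measure on a Polish space; the completion itself is in general no longer standard Borel.\<close>

definition complete_standard_borel_prob_space :: "'w measure \<Rightarrow> bool" where
  "complete_standard_borel_prob_space M \<longleftrightarrow>
     (\<exists>N. prob_space N \<and> standard_borel_measure N \<and> M = completion N)"

definition borel_prob_measures :: "'a::topological_space measure set" where
  "borel_prob_measures = space (prob_algebra borel)"

text \<open>The coarsest topology on the Borel probability measures that makes
  \<open>\<mu> \<mapsto> \<integral> f d\<mu>\<close> continuous for every bounded continuous real function \<open>f\<close>.\<close>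

definition weak_topology :: "'a::topological_space measure topology" where
  "weak_topology = topology_generated_by
     {{\<mu> \<in> borel_prob_measures. (\<integral>x. f x \<partial>\<mu>) \<in> U} | (f :: 'a \<Rightarrow> real) U. f \<in> bcontfun \<and> open U}"

definition metrizes_weak_convergence ::
    "('a::topological_space measure \<Rightarrow> 'a measure \<Rightarrow> real) \<Rightarrow> bool" where
  "metrizes_weak_convergence d \<longleftrightarrow>
     Metric_space borel_prob_measures d \<and>
     Metric_space.mtopology borel_prob_measures d = weak_topology"

definition random_measure :: "'w measure \<Rightarrow> ('w \<Rightarrow> 'a::topological_space measure) \<Rightarrow> bool" where
  "random_measure M P \<longleftrightarrow>
     P \<in> M \<rightarrow>\<^sub>M sigma borel_prob_measures {U. openin weak_topology U}"

text \<open>Processes are indexed by \<open>n \<ge> 1\<close>; the value at index \<open>0\<close> is never used.\<close>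

definition valued_process :: "'w measure \<Rightarrow> (nat \<Rightarrow> 'w \<Rightarrow> 'a::topological_space) \<Rightarrow> bool" where
  "valued_process M X \<longleftrightarrow> (\<forall>n\<ge>1. X n \<in> borel_measurable M)"

text \<open>The measure \<open>(1/n) \<Sum>\<^sub>i \<delta>(x\<^sub>i)\<close>. For \<open>n = 0\<close> it is the null measure, which is not a
  probability measure; this does not affect any limit as \<open>n\<close> tends to infinity.\<close>

definition empirical_measure :: "nat \<Rightarrow> (nat \<Rightarrow> 'a::topological_space) \<Rightarrow> 'a measure" where
  "empirical_measure n x =
     measure_of (space borel) (sets borel)
       (\<lambda>A. (\<Sum>i=1..n. emeasure (return borel (x i)) A) / of_nat n)"

definition limit_measure_in_prob ::
    "('a::topological_space measure \<Rightarrow> 'a measure \<Rightarrow> real) \<Rightarrow> 'w measure \<Rightarrow> (nat \<Rightarrow> 'w \<Rightarrow> 'a) \<Rightarrow>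
     ('w \<Rightarrow> 'a measure) \<Rightarrow> bool" where
  "limit_measure_in_prob d M X P \<longleftrightarrow>
     random_measure M P \<and>
     (\<forall>\<epsilon>>0. (\<lambda>n. measure M {\<omega> \<in> space M. d (empirical_measure n (\<lambda>i. X i \<omega>)) (P \<omega>) > \<epsilon>})
              \<longlonglongrightarrow> 0)"

definition limit_measure_AE ::
    "('a::topological_space measure \<Rightarrow> 'a measure \<Rightarrow> real) \<Rightarrow> 'w measure \<Rightarrow> (nat \<Rightarrow> 'w \<Rightarrow> 'a) \<Rightarrow>
     ('w \<Rightarrow> 'a measure) \<Rightarrow> bool" where
  "limit_measure_AE d M X P \<longleftrightarrow>
     random_measure M P \<and>
     (AE \<omega> in M. (\<lambda>n. d (empirical_measure n (\<lambda>i. X i \<omega>)) (P \<omega>)) \<longlonglongrightarrow> 0)"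

definition EWC_in_prob ::
    "('a::topological_space measure \<Rightarrow> 'a measure \<Rightarrow> real) \<Rightarrow> 'w measure \<Rightarrow> (nat \<Rightarrow> 'w \<Rightarrow> 'a) \<Rightarrow> bool"
  where "EWC_in_prob d M X \<longleftrightarrow> (\<exists>P. limit_measure_in_prob d M X P)"

definition EWC_AE ::
    "('a::topological_space measure \<Rightarrow> 'a measure \<Rightarrow> real) \<Rightarrow> 'w measure \<Rightarrow> (nat \<Rightarrow> 'w \<Rightarrow> 'a) \<Rightarrow> bool"
  where "EWC_AE d M X \<longleftrightarrow> (\<exists>P. limit_measure_AE d M X P)"

lemma emeasure_empirical_measure:
  assumes "A \<in> sets borel"
  shows "emeasure (empirical_measure n x) A =
           (\<Sum>i=1..n. emeasure (return borel (x i)) A) / of_nat n"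
proof (rule emeasure_measure_of[OF empirical_measure_def])
  show "countably_additive (sets (empirical_measure n x))
          (\<lambda>A. (\<Sum>i=1..n. emeasure (return borel (x i)) A) / of_nat n)"
  proof (rule countably_additiveI)
    fix B :: "nat \<Rightarrow> 'a set"
    assume B: "range B \<subseteq> sets (empirical_measure n x)" "disjoint_family B"
    have s: "sets (empirical_measure n x) = sets borel"
      unfolding empirical_measure_def using sets.sets_measure_of_eq[of borel] by simp
    have "(\<Sum>k. emeasure (return borel (x i)) (B k)) = emeasure (return borel (x i)) (\<Union>k. B k)" for i
      using B s by (intro suminf_emeasure) auto
    then show "(\<Sum>k. (\<Sum>i=1..n. emeasure (return borel (x i)) (B k)) / of_nat n) =
               (\<Sum>i=1..n. emeasure (return borel (x i)) (\<Union>k. B k)) / of_nat n"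
      by (simp add: divide_ennreal_def suminf_sum)
  qed
qed (use assms sets.space_closed in \<open>auto simp: positive_def empirical_measure_def\<close>)

lemma empirical_measure_in_borel_prob_measures:
  assumes "n \<ge> 1"
  shows "empirical_measure n x \<in> borel_prob_measures"
proof -
  have sp: "space (empirical_measure n x) = UNIV"
    by (simp add: empirical_measure_def space_measure_of_conv)
  have st: "sets (empirical_measure n x) = sets borel"
    unfolding empirical_measure_def using sets.sets_measure_of_eq[of borel] by simp
  have "emeasure (return borel (x i)) UNIV = 1" for i
    by (simp add: emeasure_return)
  then have "emeasure (empirical_measure n x) (space (empirical_measure n x)) = 1"
    using assms ennreal_divide_self[of "of_nat n"]
    by (simp add: emeasure_empirical_measure sp less_top[symmetric] ennreal_of_nat_neq_top)
  with st show ?thesis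
    by (auto simp: borel_prob_measures_def space_prob_algebra intro: prob_spaceI)
qed

lemma topspace_weak_topology [simp]: "topspace weak_topology = borel_prob_measures"
proof -
  have "(\<lambda>_. 0 :: real) \<in> bcontfun"
    by (simp add: bcontfun_def)
  then have "borel_prob_measures \<in>
      {{\<mu> \<in> borel_prob_measures. (\<integral>x. f x \<partial>\<mu>) \<in> U} | (f :: 'a \<Rightarrow> real) U. f \<in> bcontfun \<and> open U}"
    by (intro CollectI exI[of _ "\<lambda>_. 0"] exI[of _ UNIV]) auto
  then show ?thesis
    unfolding weak_topology_def topology_generated_by_topspace by blast
qed

end

theory Submission
  imports Defs
begin

text \<open>Pushing forward along the continuous map \<open>g\<close> is continuous for the weak topologies and sends
  the empirical measure of \<open>X\<close> to the empirical measure of \<open>g \<circ> X\<close>, so the almost sure statement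
  is immediate. For convergence in probability, let \<open>C\<^sub>k\<close> be the set of \<open>p\<close> having some \<open>q\<close> with
  \<open>d p q < 1/k\<close> whose image is farther than \<open>\<epsilon>\<close> from the image of \<open>p\<close>. The \<open>C\<^sub>k\<close> are open and decrease
  to the empty set, so \<open>P \<in> C\<^sub>k\<close> has small probability, and outside this event a large distance of the
  images forces \<open>d\<close> to be at least \<open>1/k\<close>. The distance between the empirical measure and its
  limit is a random variable because the empirical measures of length \<open>n\<close> lie in the closure of a
  countable set, being a continuous image of a separable space.\<close>

section \<open>Random points of a metric space\<close>

text \<open>Without separability a pair of Borel maps need not be Borel into the product, so
  \<open>d\<close> cannot simply be composed with \<open>(A, B)\<close>. As \<open>A\<close> stays
  in the closure of the countable set \<open>D\<close>, the event
  \<open>d (A \<omega>) (B \<omega>) < a\<close> is detected by points of \<open>D\<close> and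
  rational radii, hence is a countable union.\<close>

lemma (in Metric_space) borel_measurable_dist:
  assumes A: "A \<in> N \<rightarrow>\<^sub>M sigma M {U. openin mtopology U}"
    and B: "B \<in> N \<rightarrow>\<^sub>M sigma M {U. openin mtopology U}"
    and D: "countable D"
    and AD: "\<And>\<omega>. \<omega> \<in> space N \<Longrightarrow> A \<omega> \<in> mtopology closure_of D"
  shows "(\<lambda>\<omega>. d (A \<omega>) (B \<omega>)) \<in> borel_measurable N"
proof -
  have sub: "{U. openin mtopology U} \<subseteq> Pow M"
    using openin_subset by fastforce
  have ball: "mball x r \<in> sets (sigma M {U. openin mtopology U})" for x r
    using sub by (simp add: sigma_sets.Basic)
  have inM: "A \<omega> \<in> M" "B \<omega> \<in> M" if "\<omega> \<in> space N" for \<omega>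
    using measurable_space[OF A that] measurable_space[OF B that] sub
    by (auto simp: space_measure_of)
  have "{\<omega> \<in> space N. d (A \<omega>) (B \<omega>) < a} \<in> sets N" for a
  proof -
    have "{\<omega> \<in> space N. d (A \<omega>) (B \<omega>) < a} =
        (\<Union>x\<in>D. \<Union>q\<in>\<rat>. (A -` mball x q \<inter> space N) \<inter> (B -` mball x (a - q) \<inter> space N))"
      (is "?L = ?R")
    proof
      show "?L \<subseteq> ?R"
      proof safe
        fix \<omega> assume \<omega>: "\<omega> \<in> space N" and less: "d (A \<omega>) (B \<omega>) < a"
        \<comment> \<open>Half the slack: for \<open>q < r\<close> the triangle inequality gives
          \<open>d x (B \<omega>) < q + (a - 2 * r)\<close>, which is below
          \<open>a - q\<close>.\<close>
        define r where "r = (a - d (A \<omega>) (B \<omega>)) / 2"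
        have "r > 0" using less by (simp add: r_def)
        then obtain x where x: "x \<in> D" "x \<in> M" "d (A \<omega>) x < r"
          using AD[OF \<omega>] by (auto simp: metric_closure_of)
        obtain q where q: "q \<in> \<rat>" "d (A \<omega>) x < q" "q < r"
          using Rats_dense_in_real[OF x(3)] by blast
        have "d x (B \<omega>) \<le> d (A \<omega>) x + d (A \<omega>) (B \<omega>)"
          using triangle[OF x(2) inM[OF \<omega>]] by (simp add: commute)
        then have "d x (B \<omega>) < a - q"
          using q unfolding r_def by (simp add: field_simps)
        then show "\<omega> \<in> ?R"
          using x q inM[OF \<omega>] \<omega> by (auto simp: commute)
      qed
      show "?R \<subseteq> ?L"
      proof clarsimp
        fix \<omega> x q assume "x \<in> M" "A \<omega> \<in> M" "B \<omega> \<in> M" "d x (A \<omega>) < q" "d x (B \<omega>) < a - q"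
        then show "d (A \<omega>) (B \<omega>) < a"
          using triangle[of "A \<omega>" x "B \<omega>"] by (simp add: commute)
      qed
    qed
    also have "\<dots> \<in> sets N"
      using D countable_rat measurable_sets[OF A ball] measurable_sets[OF B ball]
      by (intro sets.countable_UN' sets.Int) auto
    finally show ?thesis .
  qed
  then show ?thesis
    by (simp add: borel_measurable_iff_less)
qed

lemma (in prob_space) continuous_mapping_in_prob:
  fixes A :: "nat \<Rightarrow> 'a \<Rightarrow> 'b" and F :: "'b \<Rightarrow> 'c"
  assumes S: "Metric_space S dS" and T: "Metric_space T dT"
    and F: "continuous_map (Metric_space.mtopology S dS) (Metric_space.mtopology T dT) F"
    and B: "B \<in> M \<rightarrow>\<^sub>M sigma S {U. openin (Metric_space.mtopology S dS) U}"
    and A: "\<And>n \<omega>. n \<ge> 1 \<Longrightarrow> \<omega> \<in> space M \<Longrightarrow> A n \<omega> \<in> S"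
    and AB: "\<And>n. n \<ge> 1 \<Longrightarrow> (\<lambda>\<omega>. dS (A n \<omega>) (B \<omega>)) \<in> borel_measurable M"
    and lim: "\<And>e. e > 0 \<Longrightarrow> (\<lambda>n. prob {\<omega> \<in> space M. dS (A n \<omega>) (B \<omega>) > e}) \<longlonglongrightarrow> 0"
    and "e > 0"
  shows "(\<lambda>n. prob {\<omega> \<in> space M. dT (F (A n \<omega>)) (F (B \<omega>)) > e}) \<longlonglongrightarrow> 0"
proof -
  interpret S: Metric_space S dS by fact
  interpret T: Metric_space T dT by fact
  have sub: "{U. openin S.mtopology U} \<subseteq> Pow S"
    using openin_subset by fastforce
  have BS: "B \<omega> \<in> S" if "\<omega> \<in> space M" for \<omega>
    using measurable_space[OF B that] sub by (auto simp: space_measure_of)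
  have FT: "F p \<in> T" if "p \<in> S" for p
    using continuous_map_image_subset_topspace[OF F] that by auto
  define C where "C k = {p \<in> S. \<exists>q\<in>S. dS p q < inverse (real (Suc k)) \<and> e < dT (F q) (F p)}" for k
  have "openin S.mtopology (C k)" for k
  proof -
    \<comment> \<open>Sliced by the witness \<open>q\<close>, the set becomes a union of open sets:
      for fixed \<open>q\<close> both conditions on \<open>p\<close> are open, the second as a
      preimage of the complement of a closed ball.\<close>
    define V where "V q = S.mball q (inverse (real (Suc k))) \<inter>
        {p \<in> topspace S.mtopology. F p \<in> topspace T.mtopology - T.mcball (F q) e}" for q
    have "C k = (\<Union>q\<in>S. V q)"
      using FT by (auto simp: C_def V_def S.commute)
    moreover have "openin S.mtopology (V q)" for q
      unfolding V_def
      by (intro openin_Int S.openin_mball openin_continuous_map_preimage[OF F] openin_diff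
          openin_topspace T.closedin_mcball)
    ultimately show ?thesis by auto
  qed
  then have "C k \<in> sets (sigma S {U. openin S.mtopology U})" for k
    using sub by (simp add: sigma_sets.Basic)
  from measurable_sets[OF B this]
  have C_sets: "B -` C k \<inter> space M \<in> sets M" for k .
  have "dS p q < inverse (real (Suc m))"
    if "dS p q < inverse (real (Suc n))" "m \<le> n" for p q m n
  proof -
    have "inverse (real (Suc n)) \<le> inverse (real (Suc m))"
      using that(2) by (intro le_imp_inverse_le) simp_all
    with that(1) show ?thesis by linarith
  qed
  then have "decseq (\<lambda>k. B -` C k \<inter> space M)"
    unfolding C_def decseq_def by blast
  moreover have "(\<Inter>k. B -` C k \<inter> space M) = {}"
  proof (rule ccontr)
    assume "(\<Inter>k. B -` C k \<inter> space M) \<noteq> {}"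
    then obtain \<omega> where \<omega>: "\<omega> \<in> space M" "\<And>k. B \<omega> \<in> C k" by auto
    \<comment> \<open>Continuity of \<open>F\<close> at \<open>B \<omega>\<close> bounds the
      distance of the images by \<open>e\<close> on a ball of some radius \<open>r\<close>, so no
      witness survives once \<open>inverse (real (Suc k)) < r\<close>.\<close>
    have "openin S.mtopology {p \<in> topspace S.mtopology. F p \<in> T.mball (F (B \<omega>)) e}"
      by (intro openin_continuous_map_preimage[OF F] T.openin_mball)
    moreover have "B \<omega> \<in> {p \<in> topspace S.mtopology. F p \<in> T.mball (F (B \<omega>)) e}"
      using BS[OF \<omega>(1)] FT \<open>e > 0\<close> by auto
    ultimately obtain r where r: "r > 0"
      "S.mball (B \<omega>) r \<subseteq> {p \<in> topspace S.mtopology. F p \<in> T.mball (F (B \<omega>)) e}"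
      unfolding S.openin_mtopology by meson
    obtain k where k: "inverse (real (Suc k)) < r"
      using reals_Archimedean[OF r(1)] by auto
    obtain q where q: "q \<in> S" "dS (B \<omega>) q < inverse (real (Suc k))" "e < dT (F q) (F (B \<omega>))"
      using \<omega>(2)[of k] by (auto simp: C_def)
    then have "q \<in> S.mball (B \<omega>) r"
      using k BS[OF \<omega>(1)] by simp
    with r(2) q(3) show False by (auto simp: T.commute)
  qed
  ultimately have C_lim: "(\<lambda>k. prob (B -` C k \<inter> space M)) \<longlonglongrightarrow> 0"
    using finite_Lim_measure_decseq[of "\<lambda>k. B -` C k \<inter> space M"] C_sets by auto
  show ?thesis
  proof (rule order_tendstoI)
    fix a :: real assume "a < 0"
    then show "\<forall>\<^sub>F n in sequentially. a < prob {\<omega> \<in> space M. dT (F (A n \<omega>)) (F (B \<omega>)) > e}"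
      by (intro always_eventually allI less_le_trans[OF _ measure_nonneg])
  next
    fix a :: real assume "0 < a"
    then obtain k where k: "prob (B -` C k \<inter> space M) < a / 2"
      using order_tendstoD(2)[OF C_lim, of "a / 2"] by (auto simp: eventually_sequentially)
    \<comment> \<open>Outside \<open>C k\<close> only \<open>dS \<ge> inverse (real (Suc k))\<close>
      is obtained, while \<open>lim\<close> concerns a strict inequality; halving the radius bridges
      the two.\<close>
    define r where "r = inverse (real (Suc k)) / 2"
    have r: "r > 0" "r < inverse (real (Suc k))" by (auto simp: r_def)
    have "\<forall>\<^sub>F n in sequentially. prob {\<omega> \<in> space M. dS (A n \<omega>) (B \<omega>) > r} < a / 2"
      using order_tendstoD(2)[OF lim[OF r(1)], of "a / 2"] \<open>0 < a\<close> by simp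
    then show "\<forall>\<^sub>F n in sequentially. prob {\<omega> \<in> space M. dT (F (A n \<omega>)) (F (B \<omega>)) > e} < a"
      using eventually_ge_at_top[of 1]
    proof eventually_elim
      case (elim n)
      let ?D = "{\<omega> \<in> space M. dS (A n \<omega>) (B \<omega>) > r}"
      have D: "?D \<in> sets M"
        using AB[OF elim(2)] by measurable
      have "{\<omega> \<in> space M. dT (F (A n \<omega>)) (F (B \<omega>)) > e} \<subseteq> ?D \<union> (B -` C k \<inter> space M)"
      proof
        fix \<omega> assume "\<omega> \<in> {\<omega> \<in> space M. dT (F (A n \<omega>)) (F (B \<omega>)) > e}"
        then have \<omega>: "\<omega> \<in> space M" "e < dT (F (A n \<omega>)) (F (B \<omega>))" by auto
        show "\<omega> \<in> ?D \<union> (B -` C k \<inter> space M)"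
        proof (cases "B \<omega> \<in> C k")
          case False
          \<comment> \<open>Otherwise \<open>A n \<omega>\<close> itself would be the witness
            \<open>q\<close> placing \<open>B \<omega>\<close> in \<open>C k\<close>.\<close>
          then have "\<not> dS (B \<omega>) (A n \<omega>) < inverse (real (Suc k))"
            using \<omega> BS A[OF elim(2)] unfolding C_def by blast
          then show ?thesis
            using \<omega>(1) r by (simp add: S.commute)
        qed (use \<omega>(1) in auto)
      qed
      then have "prob {\<omega> \<in> space M. dT (F (A n \<omega>)) (F (B \<omega>)) > e} \<le>
          prob (?D \<union> (B -` C k \<inter> space M))"
        \<comment> \<open>Monotonicity asks for measurability of the larger event alone; this is
          where measurability of the distance in \<open>S\<close> enters, through
          \<open>D\<close>.\<close>
        using D C_sets by (intro finite_measure_mono) auto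
      also have "\<dots> \<le> prob ?D + prob (B -` C k \<inter> space M)"
        using D C_sets by (intro measure_Un_le)
      also have "\<dots> < a"
        using elim(1) k by simp
      finally show ?case .
    qed
  qed
qed

section \<open>Empirical measures and pushforwards in the weak topology\<close>

lemma borel_prob_measures_iff:
  "\<mu> \<in> borel_prob_measures \<longleftrightarrow> prob_space \<mu> \<and> sets \<mu> = sets borel"
  by (auto simp: borel_prob_measures_def space_prob_algebra)

text \<open>The weak topology is generated by preimages of open sets under the integrals, so
  continuity can be tested on this subbasis.\<close>

lemma continuous_map_into_weak_topology:
  fixes F :: "'b \<Rightarrow> 'a::topological_space measure"
  assumes "\<And>x. x \<in> topspace T \<Longrightarrow> F x \<in> borel_prob_measures"
    and "\<And>f :: 'a \<Rightarrow> real. f \<in> bcontfun \<Longrightarrow> continuous_map T euclideanreal (\<lambda>x. \<integral>y. f y \<partial>(F x))"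
  shows "continuous_map T weak_topology F"
  unfolding weak_topology_def
proof (rule continuous_on_generated_topo)
  fix W
  assume "W \<in> {{\<mu> \<in> borel_prob_measures. (\<integral>x. f x \<partial>\<mu>) \<in> U} | (f :: 'a \<Rightarrow> real) U. f \<in> bcontfun \<and> open U}"
  then obtain f :: "'a \<Rightarrow> real" and U where f: "f \<in> bcontfun" "open U"
    and W: "W = {\<mu> \<in> borel_prob_measures. (\<integral>x. f x \<partial>\<mu>) \<in> U}" by blast
  have "F -` W \<inter> topspace T = {x \<in> topspace T. (\<integral>y. f y \<partial>(F x)) \<in> U}"
    using assms(1) by (auto simp: W)
  also have "openin T \<dots>"
    using assms(2)[OF f(1)] f(2) by (intro openin_continuous_map_preimage) auto
  finally show "openin T (F -` W \<inter> topspace T)" .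
next
  show "F ` topspace T \<subseteq>
      \<Union> {{\<mu> \<in> borel_prob_measures. (\<integral>x. f x \<partial>\<mu>) \<in> U} | (f :: 'a \<Rightarrow> real) U. f \<in> bcontfun \<and> open U}"
    using assms(1) topspace_weak_topology
    unfolding weak_topology_def topology_generated_by_topspace by blast
qed

lemma continuous_map_integral_weak_topology:
  assumes "f \<in> bcontfun"
  shows "continuous_map weak_topology euclideanreal (\<lambda>\<mu>. \<integral>x. f x \<partial>\<mu>)"
proof (unfold continuous_map_alt, safe)
  fix U :: "real set" assume "openin euclideanreal U"
  then have "openin weak_topology {\<mu> \<in> borel_prob_measures. (\<integral>x. f x \<partial>\<mu>) \<in> U}"
    unfolding weak_topology_def using assms by (intro topology_generated_by_Basis) auto
  moreover have "{\<mu> \<in> borel_prob_measures. (\<integral>x. f x \<partial>\<mu>) \<in> U} =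
      (\<lambda>\<mu>. \<integral>x. f x \<partial>\<mu>) -` U \<inter> topspace weak_topology" by auto
  ultimately show "openin weak_topology ((\<lambda>\<mu>. \<integral>x. f x \<partial>\<mu>) -` U \<inter> topspace weak_topology)"
    by simp
qed auto

text \<open>By change of variables, integrating \<open>f\<close> against the pushforward is
  integrating \<open>f\<close> composed with \<open>g\<close>, which is again bounded and
  continuous.\<close>

lemma continuous_map_distr_weak_topology:
  fixes g :: "'a::topological_space \<Rightarrow> 'b::topological_space"
  assumes g: "continuous_on UNIV g"
  shows "continuous_map weak_topology weak_topology (\<lambda>\<mu>. distr \<mu> borel g)"
proof (rule continuous_map_into_weak_topology)
  have gm: "g \<in> \<mu> \<rightarrow>\<^sub>M borel" if "\<mu> \<in> borel_prob_measures" for \<mu>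
    using that borel_measurable_continuous_onI[OF g]
    by (simp add: borel_prob_measures_iff cong: measurable_cong_sets)
  show "distr \<mu> borel g \<in> borel_prob_measures" if "\<mu> \<in> topspace weak_topology" for \<mu>
    using that gm[of \<mu>] by (simp add: borel_prob_measures_iff prob_space.prob_space_distr)
  fix f :: "'b \<Rightarrow> real" assume f: "f \<in> bcontfun"
  then have fc: "continuous_on UNIV f" by (simp add: bcontfun_def)
  have "(\<lambda>x. f (g x)) \<in> bcontfun"
    using f continuous_on_compose2[OF fc g]
    by (auto simp: bcontfun_def intro: bounded_subset)
  from continuous_map_integral_weak_topology[OF this]
  show "continuous_map weak_topology euclideanreal (\<lambda>\<mu>. \<integral>x. f x \<partial>(distr \<mu> borel g))"
    by (rule continuous_map_eq)
      (simp add: integral_distr gm borel_measurable_continuous_onI[OF fc])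
qed

text \<open>Seeing the sample as a function of a uniformly chosen index gives access to the rules
  for \<open>distr\<close> in computing pushforwards and integrals.\<close>

lemma empirical_measure_eq_distr:
  "empirical_measure n x = distr (uniform_count_measure {1..n}) borel x"
proof (rule measure_eqI)
  show s: "sets (empirical_measure n x) = sets (distr (uniform_count_measure {1..n}) borel x)"
    unfolding empirical_measure_def using sets.sets_measure_of_eq[of borel] by simp
  fix A assume "A \<in> sets (empirical_measure n x)"
  then have A: "A \<in> sets borel" using s by simp
  have "(\<Sum>i=1..n. indicator A (x i) :: ennreal) = of_nat (card (x -` A \<inter> {1..n}))"
    by (simp add: indicator_def sum.If_cases vimage_def Int_def conj_commute)
  moreover have "x \<in> uniform_count_measure {1..n} \<rightarrow>\<^sub>M borel"
    by (simp add: measurable_def sets_uniform_count_measure space_uniform_count_measure)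
  ultimately show "emeasure (empirical_measure n x) A =
      emeasure (distr (uniform_count_measure {1..n}) borel x) A"
    using A
    \<comment> \<open>For \<open>n = 0\<close> both sides vanish: in \<open>ennreal\<close>,
      \<open>0 / 0 = 0\<close>, and the index space is empty.\<close>
    by (cases "n = 0")
      (simp_all add: emeasure_empirical_measure emeasure_distr emeasure_uniform_count_measure
        space_uniform_count_measure divide_ennreal ennreal_of_nat_eq_real_of_nat)
qed

lemma distr_empirical_measure:
  assumes "g \<in> borel_measurable borel"
  shows "distr (empirical_measure n x) borel g = empirical_measure n (\<lambda>i. g (x i))"
  using assms unfolding empirical_measure_eq_distr
  by (subst distr_distr)
    (auto simp: measurable_def sets_uniform_count_measure space_uniform_count_measure o_def)

lemma integral_empirical_measure:
  fixes f :: "'a::topological_space \<Rightarrow> real"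
  assumes "f \<in> borel_measurable borel"
  shows "(\<integral>y. f y \<partial>(empirical_measure n x)) = (\<Sum>i=1..n. f (x i)) / n"
  using assms unfolding empirical_measure_eq_distr
  by (subst integral_distr)
    (auto simp: measurable_def sets_uniform_count_measure space_uniform_count_measure
      integral_uniform_count_measure)

text \<open>Sequences carry the product topology, and each test integral is a finite average of
  continuous functions of coordinates. Both measurability and separability of the range are drawn
  from this continuity.\<close>

lemma continuous_map_empirical_measure:
  assumes "n \<ge> 1"
  shows "continuous_map euclidean weak_topology (empirical_measure n)"
proof (rule continuous_map_into_weak_topology)
  show "empirical_measure n x \<in> borel_prob_measures" for x :: "nat \<Rightarrow> 'a"
    by (rule empirical_measure_in_borel_prob_measures[OF assms])
  fix f :: "'a \<Rightarrow> real" assume "f \<in> bcontfun"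
  then have f: "continuous_on UNIV f" by (simp add: bcontfun_def)
  have "continuous_on UNIV (\<lambda>x::nat \<Rightarrow> 'a. (\<Sum>i=1..n. f (x i)) / n)"
    using assms
    by (intro continuous_intros continuous_on_compose2[OF f continuous_on_product_coordinates]) auto
  then show "continuous_map euclidean euclideanreal (\<lambda>x. \<integral>y. f y \<partial>(empirical_measure n x))"
    by (simp add: integral_empirical_measure borel_measurable_continuous_onI[OF f])
qed

text \<open>Borel measurability of continuous maps, in terms of \<open>sigma\<close> because the
  weak topology is a topology on a carrier set and not the one of a type class.\<close>

lemma continuous_map_measurable_sigma:
  assumes "continuous_map T T' F"
  shows "F \<in> sigma (topspace T) {U. openin T U} \<rightarrow>\<^sub>M sigma (topspace T') {U. openin T' U}"
proof (rule measurable_measure_of)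
  have sub: "{U. openin T U} \<subseteq> Pow (topspace T)"
    using openin_subset by auto
  show "{U. openin T' U} \<subseteq> Pow (topspace T')"
    using openin_subset by auto
  show "F \<in> space (sigma (topspace T) {U. openin T U}) \<rightarrow> topspace T'"
    using continuous_map_image_subset_topspace[OF assms] sub by (auto simp: space_measure_of)
  fix U assume "U \<in> {U. openin T' U}"
  then show "F -` U \<inter> space (sigma (topspace T) {U. openin T U})
      \<in> sets (sigma (topspace T) {U. openin T U})"
    using assms sub by (auto simp: space_measure_of continuous_map_alt intro!: sigma_sets.Basic)
qed

lemma random_measure_distr:
  assumes "random_measure M P" and "continuous_on UNIV g"
  shows "random_measure M (\<lambda>\<omega>. distr (P \<omega>) borel g)"
  using measurable_compose[OF assms(1)[unfolded random_measure_def]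
      continuous_map_measurable_sigma[OF continuous_map_distr_weak_topology[OF assms(2)],
        simplified]]
  by (simp add: random_measure_def)

text \<open>By second countability a sequence with measurable coordinates is measurable into the
  sequence space; the continuous map \<open>empirical_measure n\<close> is then applied to
  it.\<close>

lemma random_measure_empirical_measure:
  fixes X :: "nat \<Rightarrow> 'w \<Rightarrow> 'a::second_countable_topology"
  assumes "valued_process M X" and n: "n \<ge> 1"
  shows "random_measure M (\<lambda>\<omega>. empirical_measure n (\<lambda>i. X i \<omega>))"
proof -
  \<comment> \<open>\<open>X 0\<close> need not be measurable.\<close>
  have X: "(\<lambda>\<omega> i. X (max 1 i) \<omega>) \<in> borel_measurable M"
    using assms(1) by (intro measurable_coordinatewise_then_product) (auto simp: valued_process_def)
  have E: "empirical_measure n \<in> borel \<rightarrow>\<^sub>M sigma borel_prob_measures {U. openin weak_topology U}"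
    using continuous_map_measurable_sigma[OF continuous_map_empirical_measure[OF n]]
    by (simp add: borel_def)
  have "empirical_measure n (\<lambda>i. X (max 1 i) \<omega>) = empirical_measure n (\<lambda>i. X i \<omega>)" for \<omega>
    unfolding empirical_measure_def by (simp add: max_def cong: sum.cong_simp)
  with measurable_compose[OF X E] show ?thesis
    by (simp add: random_measure_def)
qed

text \<open>Supplies the countable set for \<open>borel_measurable_dist\<close>: a continuous map
  sends a countable dense set of sequences to a dense subset of its range. Separability of the whole
  space of measures is thus not invoked.\<close>

lemma empirical_measure_closure_of_countable:
  assumes n: "n \<ge> 1"
  obtains D :: "'a::second_countable_topology measure set"
  where "countable D" "\<And>x. empirical_measure n x \<in> weak_topology closure_of D"
proof -
  obtain D0 :: "(nat \<Rightarrow> 'a) set" where D0: "countable D0"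
    and dense: "\<And>U. open U \<Longrightarrow> U \<noteq> {} \<Longrightarrow> \<exists>d\<in>D0. d \<in> U"
    using countable_dense_exists by metis
  have "x \<in> euclidean closure_of D0" for x
    unfolding in_closure_of
  proof safe
    fix U assume "x \<in> U" "openin euclidean U"
    then show "\<exists>y. y \<in> D0 \<and> y \<in> U"
      using dense[of U] by auto
  qed simp
  then have "empirical_measure n x \<in> weak_topology closure_of (empirical_measure n ` D0)" for x
    using continuous_map_image_closure_subset[OF continuous_map_empirical_measure[OF n]] by blast
  with D0 show thesis
    by (intro that[of "empirical_measure n ` D0"]) auto
qed

theorem theorem3p17:
  fixes M :: "'w measure"
    and X :: "nat \<Rightarrow> 'w \<Rightarrow> 'a::polish_space"
    and g :: "'a \<Rightarrow> 'b::polish_space"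
    and P :: "'w \<Rightarrow> 'a measure"
    and dX :: "'a measure \<Rightarrow> 'a measure \<Rightarrow> real"
    and dY :: "'b measure \<Rightarrow> 'b measure \<Rightarrow> real"
  assumes "complete_standard_borel_prob_space M"
    and "metrizes_weak_convergence dX"
    and "metrizes_weak_convergence dY"
    and "valued_process M X"
    and "continuous_on UNIV g"
  shows "valued_process M (\<lambda>n \<omega>. g (X n \<omega>)) \<and>
         (limit_measure_in_prob dX M X P \<longrightarrow>
            EWC_in_prob dY M (\<lambda>n \<omega>. g (X n \<omega>)) \<and>
            limit_measure_in_prob dY M (\<lambda>n \<omega>. g (X n \<omega>)) (\<lambda>\<omega>. distr (P \<omega>) borel g)) \<and>
         (limit_measure_AE dX M X P \<longrightarrow>
            EWC_AE dY M (\<lambda>n \<omega>. g (X n \<omega>)) \<and>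
            limit_measure_AE dY M (\<lambda>n \<omega>. g (X n \<omega>)) (\<lambda>\<omega>. distr (P \<omega>) borel g))"
proof -
  interpret prob_space M
    using assms(1) unfolding complete_standard_borel_prob_space_def
    by (auto intro!: prob_spaceI simp: prob_space.emeasure_space_1)
  interpret dX: Metric_space borel_prob_measures dX
    using assms(2) by (simp add: metrizes_weak_convergence_def)
  interpret dY: Metric_space borel_prob_measures dY
    using assms(3) by (simp add: metrizes_weak_convergence_def)
  have topX: "dX.mtopology = weak_topology" and topY: "dY.mtopology = weak_topology"
    using assms(2,3) by (simp_all add: metrizes_weak_convergence_def)
  let ?E = "\<lambda>n \<omega>. empirical_measure n (\<lambda>i. X i \<omega>)" and ?F = "\<lambda>\<mu>. distr \<mu> borel g"
  have gm: "g \<in> borel_measurable borel"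
    using assms(5) by (rule borel_measurable_continuous_onI)
  have E: "?E n \<omega> \<in> borel_prob_measures" if "n \<ge> 1" for n \<omega>
    using that by (rule empirical_measure_in_borel_prob_measures)
  have F: "continuous_map weak_topology weak_topology ?F"
    using assms(5) by (rule continuous_map_distr_weak_topology)
  \<comment> \<open>Rewriting with this identity turns both limit claims into the continuous mapping
    theorem for \<open>?F\<close>.\<close>
  have FE: "empirical_measure n (\<lambda>i. g (X i \<omega>)) = ?F (?E n \<omega>)" for n \<omega>
    by (simp add: distr_empirical_measure[OF gm])
  have FB: "?F \<mu> \<in> borel_prob_measures" if "\<mu> \<in> borel_prob_measures" for \<mu>
    using continuous_map_image_subset_topspace[OF F] that by auto
  have "valued_process M (\<lambda>n \<omega>. g (X n \<omega>))"
    using assms(4) measurable_compose[OF _ gm] by (auto simp: valued_process_def)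
  moreover have "limit_measure_in_prob dY M (\<lambda>n \<omega>. g (X n \<omega>)) (\<lambda>\<omega>. ?F (P \<omega>))"
    if P: "limit_measure_in_prob dX M X P"
    unfolding limit_measure_in_prob_def FE
  proof (intro conjI allI impI)
    have RP: "random_measure M P"
      using P by (simp add: limit_measure_in_prob_def)
    then show "random_measure M (\<lambda>\<omega>. ?F (P \<omega>))"
      using assms(5) by (rule random_measure_distr)
    have meas: "(\<lambda>\<omega>. dX (?E n \<omega>) (P \<omega>)) \<in> borel_measurable M" if n: "n \<ge> 1" for n
    proof -
      obtain D :: "'a measure set" where D: "countable D"
        "\<And>x. empirical_measure n x \<in> weak_topology closure_of D"
        using empirical_measure_closure_of_countable[OF n] by blast
      show ?thesis
        using random_measure_empirical_measure[OF assms(4) n] RP D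
        by (intro dX.borel_measurable_dist[where D = D]) (simp_all add: random_measure_def topX)
    qed
    fix \<epsilon> :: real assume "0 < \<epsilon>"
    then show "(\<lambda>n. prob {\<omega> \<in> space M. \<epsilon> < dY (?F (?E n \<omega>)) (?F (P \<omega>))}) \<longlonglongrightarrow> 0"
      using P RP meas
      \<comment> \<open>Both metric topologies are rewritten to \<open>weak_topology\<close>, so
        that \<open>F\<close> applies whichever metrizing \<open>dX\<close> and \<open>dY\<close>
        are given.\<close>
      by (intro continuous_mapping_in_prob[OF dX.Metric_space_axioms dY.Metric_space_axioms,
            unfolded topX topY, OF F _ E])
        (auto simp: limit_measure_in_prob_def random_measure_def)
  qed
  moreover have "limit_measure_AE dY M (\<lambda>n \<omega>. g (X n \<omega>)) (\<lambda>\<omega>. ?F (P \<omega>))"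
    if P: "limit_measure_AE dX M X P"
    unfolding limit_measure_AE_def FE
  proof (intro conjI)
    have RP: "random_measure M P"
      and lim: "AE \<omega> in M. (\<lambda>n. dX (?E n \<omega>) (P \<omega>)) \<longlonglongrightarrow> 0"
      using P by (simp_all add: limit_measure_AE_def)
    from RP show "random_measure M (\<lambda>\<omega>. ?F (P \<omega>))"
      using assms(5) by (rule random_measure_distr)
    have PB: "P \<omega> \<in> borel_prob_measures" if "\<omega> \<in> space M" for \<omega>
    proof -
      have "{U. openin weak_topology U} \<subseteq> Pow (borel_prob_measures :: 'a measure set)"
        using openin_subset[of weak_topology] by auto
      then show ?thesis
        using measurable_space[OF RP[unfolded random_measure_def] that]
        by (simp add: space_measure_of)
    qed
    show "AE \<omega> in M. (\<lambda>n. dY (?F (?E n \<omega>)) (?F (P \<omega>))) \<longlonglongrightarrow> 0"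
      using lim AE_space
    proof eventually_elim
      case (elim \<omega>)
      have "limitin dX.mtopology (\<lambda>n. ?E n \<omega>) (P \<omega>) sequentially"
        unfolding dX.limitin_metric_dist_null
        \<comment> \<open>Membership in the carrier holds only from index 1 on, since the empirical
          measure for \<open>n = 0\<close> is null.\<close>
        using elim PB E by (auto intro: eventually_sequentiallyI[of 1])
      then have "limitin dY.mtopology (?F \<circ> (\<lambda>n. ?E n \<omega>)) (?F (P \<omega>)) sequentially"
        unfolding topX topY using continuous_map_limit[OF F] by blast
      then show ?case
        by (simp add: dY.limitin_metric_dist_null)
    qed
  qed
  ultimately show ?thesis
    unfolding EWC_in_prob_def EWC_AE_def by blast
qed

end
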